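(* There exist a set algebra $(J,\mathcal{B})$ and a bounded submodular set function $\psi\colon\mathcal{B}\to\mathbb{R}$ with $\psi(\emptyset)=0$ that does not admit a monotonic diff-decomposition.
   Context: A set algebra $(J,\mathcal{B})$ is a set $J$ with a family $\mathcal{B}$ of subsets of $J$ closed under complements and finite unions. A set function $\varphi\colon\mathcal{B}\to\mathbb{R}$ is increasing if $X\subseteq Y$ implies $\varphi(X)\le\varphi(Y)$, bounded if there is $b\in\mathbb{R}$ with $-b\le\varphi(X)\le b$ for all $X\in\mathcal{B}$, and submodular if $\varphi(X)+\varphi(Y)\ge\varphi(X\cap Y)+\varphi(X\cup Y)$ for all $X,Y\in\mathcal{B}$. A monotonic diff-decomposition of $\varphi$ (with $\varphi(\emptyset)=0$) is an expression $\varphi=\varphi_1-\varphi_2$ where $\varphi_1,\varphi_2\colon\mathcal{B}\to\mathbb{R}$ are both increasing and submodular, and $\varphi_1(\emptyset)=\varphi_2(\emptyset)=0$. *)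

theory Defs
  imports "HOL-Analysis.Analysis"
begin

(* A set function on the family B is a total HOL function whose values outside B are irrelevant.
   Set algebras are the library's algebra J B, increasing set functions its increasing B phi,
   and phi is bounded on B if bounded (phi ` B). *)

definition submodular_on :: "'a set set \<Rightarrow> ('a set \<Rightarrow> real) \<Rightarrow> bool" where
  "submodular_on B \<phi> \<longleftrightarrow>
     (\<forall>X\<in>B. \<forall>Y\<in>B. \<phi> X + \<phi> Y \<ge> \<phi> (X \<inter> Y) + \<phi> (X \<union> Y))"

definition monotonic_diff_decomposition ::
  "'a set set \<Rightarrow> ('a set \<Rightarrow> real) \<Rightarrow> ('a set \<Rightarrow> real) \<Rightarrow> ('a set \<Rightarrow> real) \<Rightarrow> bool" where
  "monotonic_diff_decomposition B \<phi> \<phi>\<^sub>1 \<phi>\<^sub>2 \<longleftrightarrow>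
     increasing B \<phi>\<^sub>1 \<and> submodular_on B \<phi>\<^sub>1 \<and> \<phi>\<^sub>1 {} = 0 \<and>
     increasing B \<phi>\<^sub>2 \<and> submodular_on B \<phi>\<^sub>2 \<and> \<phi>\<^sub>2 {} = 0 \<and>
     (\<forall>X\<in>B. \<phi> X = \<phi>\<^sub>1 X - \<phi>\<^sub>2 X)"

end

theory Submission
  imports Defs
begin

text \<open>
  The witness is the indicator \<open>\<psi>\<close> of the nontrivial subsets of an infinite set \<open>J\<close>: it is \<open>0\<close> on
  \<open>\<emptyset>\<close> and on \<open>J\<close>, and \<open>1\<close> elsewhere. Suppose \<open>\<psi> = \<phi>\<^sub>1 - \<phi>\<^sub>2\<close> is a monotonic diff-decomposition.
  Adding a last point \<open>x\<close> to \<open>J - {x}\<close> lowers \<open>\<psi>\<close> by \<open>1\<close>, and since \<open>\<phi>\<^sub>1\<close> increases, it must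
  raise \<open>\<phi>\<^sub>2\<close> by at least \<open>1\<close>. Submodularity of \<open>\<phi>\<^sub>2\<close> says that adding \<open>x\<close> to a smaller set raises
  \<open>\<phi>\<^sub>2\<close> at least as much. Hence each point removed from \<open>J\<close> costs at least \<open>1\<close>, and removing \<open>n\<close>
  points one after the other gives \<open>\<phi>\<^sub>2 J \<ge> n\<close> for every \<open>n\<close>, which is absurd.
\<close>

definition nontrivial_indicator :: "'a set \<Rightarrow> 'a set \<Rightarrow> real" where
  "nontrivial_indicator J X = (if X = {} \<or> X = J then 0 else 1)"

text \<open>
  If \<open>X\<close> or \<open>Y\<close> is \<open>\<emptyset>\<close> or \<open>J\<close>, then the pairs \<open>X, Y\<close> and \<open>X \<inter> Y, X \<union> Y\<close> coincide up to order.
  Otherwise the left-hand side of the submodular inequality is \<open>2\<close>, the largest possible value of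
  its right-hand side.
\<close>

lemma submodular_on_nontrivial_indicator:
  "submodular_on (Pow J) (nontrivial_indicator J)"
  unfolding submodular_on_def nontrivial_indicator_def
  by (auto simp: Un_absorb1 Un_absorb2 Int_absorb1 Int_absorb2)

text \<open>
  The marginal value of \<open>x\<close> is smallest at \<open>J - {x}\<close>, so a lower bound for it there bounds the drop
  of \<open>\<phi>\<close> when points are removed from \<open>J\<close> one at a time.
\<close>

lemma submodular_on_Diff_finite:
  fixes \<phi> :: "'a set \<Rightarrow> real"
  assumes sub: "submodular_on (Pow J) \<phi>"
    and last_marginal: "\<And>x. x \<in> J \<Longrightarrow> \<phi> (J - {x}) + c \<le> \<phi> J"
    and "finite F" "F \<subseteq> J"
  shows "\<phi> (J - F) + real (card F) * c \<le> \<phi> J"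
  using \<open>finite F\<close> \<open>F \<subseteq> J\<close>
proof (induction F)
  case empty
  then show ?case by simp
next
  case (insert x F)
  have "\<phi> ((J - F) \<inter> (J - {x})) + \<phi> ((J - F) \<union> (J - {x})) \<le> \<phi> (J - F) + \<phi> (J - {x})"
    using sub unfolding submodular_on_def by blast
  moreover have "(J - F) \<inter> (J - {x}) = J - insert x F" "(J - F) \<union> (J - {x}) = J"
    using insert.hyps by auto
  ultimately have "\<phi> (J - insert x F) + c \<le> \<phi> (J - F)"
    using last_marginal[of x] insert.prems by simp
  then show ?case
    using insert by (simp add: algebra_simps)
qed

lemma no_monotonic_diff_decomposition_nontrivial_indicator:
  assumes "infinite J"
  shows "\<not> monotonic_diff_decomposition (Pow J) (nontrivial_indicator J) \<phi>\<^sub>1 \<phi>\<^sub>2"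
proof
  assume dec: "monotonic_diff_decomposition (Pow J) (nontrivial_indicator J) \<phi>\<^sub>1 \<phi>\<^sub>2"
  then have mono1: "increasing (Pow J) \<phi>\<^sub>1" and mono2: "increasing (Pow J) \<phi>\<^sub>2"
    and sub2: "submodular_on (Pow J) \<phi>\<^sub>2" and "\<phi>\<^sub>2 {} = 0"
    and diff: "\<And>X. X \<subseteq> J \<Longrightarrow> nontrivial_indicator J X = \<phi>\<^sub>1 X - \<phi>\<^sub>2 X"
    unfolding monotonic_diff_decomposition_def by auto
  have last_marginal: "\<phi>\<^sub>2 (J - {x}) + 1 \<le> \<phi>\<^sub>2 J" if "x \<in> J" for x
  proof -
    have "J - {x} \<noteq> {}"
      using \<open>infinite J\<close> by (metis finite.emptyI infinite_remove)
    then have "nontrivial_indicator J (J - {x}) = 1" "nontrivial_indicator J J = 0"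
      using that by (auto simp: nontrivial_indicator_def)
    moreover have "\<phi>\<^sub>1 (J - {x}) \<le> \<phi>\<^sub>1 J"
      using mono1 by (auto simp: increasing_def)
    ultimately show ?thesis
      using diff[of "J - {x}"] diff[of J] by auto
  qed
  have "real n \<le> \<phi>\<^sub>2 J" for n
  proof -
    obtain F where F: "finite F" "card F = n" "F \<subseteq> J"
      using infinite_arbitrarily_large[OF \<open>infinite J\<close>] by blast
    have "0 \<le> \<phi>\<^sub>2 (J - F)"
      using mono2 \<open>\<phi>\<^sub>2 {} = 0\<close> unfolding increasing_def
      by (metis Diff_subset Pow_iff empty_subsetI)
    with submodular_on_Diff_finite[OF sub2 last_marginal F(1,3)] F(2) show ?thesis
      by simp
  qed
  then show False
    using reals_Archimedean2 by (metis not_less)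
qed

theorem corollary5p12:
  shows "\<exists>(J :: nat set) (B :: nat set set) (\<psi> :: nat set \<Rightarrow> real).
           algebra J B \<and> bounded (\<psi> ` B) \<and> submodular_on B \<psi> \<and> \<psi> {} = 0 \<and>
           \<not> (\<exists>\<phi>\<^sub>1 \<phi>\<^sub>2. monotonic_diff_decomposition B \<psi> \<phi>\<^sub>1 \<phi>\<^sub>2)"
proof (intro exI conjI)
  let ?J = "UNIV :: nat set"
  show "algebra ?J (Pow ?J)"
    by (rule algebra_Pow)
  have "nontrivial_indicator ?J ` Pow ?J \<subseteq> {0, 1}"
    by (auto simp: nontrivial_indicator_def)
  then show "bounded (nontrivial_indicator ?J ` Pow ?J)"
    by (rule bounded_subset[rotated]) simp
  show "submodular_on (Pow ?J) (nontrivial_indicator ?J)"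
    by (rule submodular_on_nontrivial_indicator)
  show "nontrivial_indicator ?J {} = 0"
    by (simp add: nontrivial_indicator_def)
  show "\<not> (\<exists>\<phi>\<^sub>1 \<phi>\<^sub>2. monotonic_diff_decomposition (Pow ?J) (nontrivial_indicator ?J) \<phi>\<^sub>1 \<phi>\<^sub>2)"
    using no_monotonic_diff_decomposition_nontrivial_indicator[OF infinite_UNIV_nat] by blast
qed

end
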